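(* Let $G$ be a finite connected graph with $N_s$ vertices and let $U,J>0$. Let $$H_{\mathrm{exact}}=U\sum_{\bm R}(1-P_{\bm R})+J\sum_{\langle\bm R\bm R'\rangle}h_{\bm R\bm R'}.$$ Let $\phi_\alpha$ be an eigenvector of the graph Laplacian, $L_G\phi_\alpha=\lambda_\alpha\phi_\alpha$, orthogonal to the uniform vector, and set $Q_\alpha^\dagger=\sum_{\bm R}\phi_\alpha(\bm R)q_{\bm R}^\dagger$ and $S^+=\sum_{\bm R}q_{\bm R}^\dagger$. Then for every $1\le M\le N_s-1$ the normalized state $$|\alpha;M\rangle\propto(S^+)^{M-1}Q_\alpha^\dagger|0\rangle$$ is an exact eigenstate: $$H_{\mathrm{exact}}|\alpha;M\rangle=\frac J2\lambda_\alpha|\alpha;M\rangle .$$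
   Context: The vertices $\bm R$ of $G$ label cells; each cell carries four fermionic modes with creation operators $c_{\bm R,m}^\dagger$, $m=1,\dots,4$ (canonical anticommutation relations), vacuum $|0\rangle$, and number operators $\hat n_{\bm R,m}=c_{\bm R,m}^\dagger c_{\bm R,m}$. Define $q_{\bm R}^\dagger=c_{\bm R,1}^\dagger c_{\bm R,2}^\dagger c_{\bm R,3}^\dagger c_{\bm R,4}^\dagger$, $q_{\bm R}=(q_{\bm R}^\dagger)^\dagger$, $P_{\bm R}^{(0)}=\prod_m(1-\hat n_{\bm R,m})$, $P_{\bm R}^{(4)}=\prod_m\hat n_{\bm R,m}$, $P_{\bm R}=P_{\bm R}^{(0)}+P_{\bm R}^{(4)}$. For each edge $\langle\bm R\bm R'\rangle$ of $G$, $$h_{\bm R\bm R'}=\tfrac12\left[P_{\bm R}^{(4)}P_{\bm R'}^{(0)}+P_{\bm R}^{(0)}P_{\bm R'}^{(4)}-q_{\bm R}^\dagger q_{\bm R'}-q_{\bm R'}^\dagger q_{\bm R}\right].$$ $L_G=D_G-A_G$ is the Laplacian of $G$, with $A_G$ the adjacency matrix and $D_G$ the diagonal degree matrix, acting on functions on the vertices. *)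

theory Defs
  imports "HOL-Analysis.Analysis"
begin

text \<open>
  Operators on a finite-dimensional Hilbert space are complex square matrices, with \<open>**\<close> the
  operator product, \<open>mat 1\<close> the identity and \<open>*v\<close> the action on vectors. (The type class
  operations \<open>*\<close> and \<open>1\<close> on vectors are componentwise and are not used for operators.)
\<close>

type_synonym 'h operator = "complex^'h^'h"

definition dagger :: "'h::finite operator \<Rightarrow> 'h operator" where
  "dagger A = (\<chi> i j. cnj (A $ j $ i))"

definition cscale :: "complex \<Rightarrow> 'h::finite operator \<Rightarrow> 'h operator" where
  "cscale a A = (\<chi> i j. a * A $ i $ j)"

definition anticommutator :: "'h::finite operator \<Rightarrow> 'h operator \<Rightarrow> 'h operator" where
  "anticommutator A B = A ** B + B ** A"


subsection \<open>Fermionic modes\<close>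

text \<open>
  \<open>c R m\<close> is the annihilation operator of mode \<open>m\<close> in cell \<open>R\<close>; only \<open>m \<in> {1..4}\<close> is meaningful.
  The relation between two creation operators is the adjoint of the one between two annihilation
  operators, see \<open>car_creation\<close>.
\<close>

definition car :: "('v \<Rightarrow> nat \<Rightarrow> 'h::finite operator) \<Rightarrow> bool" where
  "car c \<longleftrightarrow> (\<forall>R R'. \<forall>m\<in>{1..4}. \<forall>m'\<in>{1..4}.
     anticommutator (c R m) (c R' m') = 0 \<and>
     anticommutator (c R m) (dagger (c R' m')) = (if R = R' \<and> m = m' then mat 1 else 0))"

definition vacuum :: "('v \<Rightarrow> nat \<Rightarrow> 'h::finite operator) \<Rightarrow> complex^'h \<Rightarrow> bool" where
  "vacuum c vac \<longleftrightarrow> norm vac = 1 \<and> (\<forall>R. \<forall>m\<in>{1..4}. c R m *v vac = 0)"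

definition num :: "('v \<Rightarrow> nat \<Rightarrow> 'h::finite operator) \<Rightarrow> 'v \<Rightarrow> nat \<Rightarrow> 'h operator" where
  "num c R m = dagger (c R m) ** c R m"

definition q_dag :: "('v \<Rightarrow> nat \<Rightarrow> 'h::finite operator) \<Rightarrow> 'v \<Rightarrow> 'h operator" where
  "q_dag c R = dagger (c R 1) ** dagger (c R 2) ** dagger (c R 3) ** dagger (c R 4)"

definition q_op :: "('v \<Rightarrow> nat \<Rightarrow> 'h::finite operator) \<Rightarrow> 'v \<Rightarrow> 'h operator" where
  "q_op c R = dagger (q_dag c R)"

definition P0 :: "('v \<Rightarrow> nat \<Rightarrow> 'h::finite operator) \<Rightarrow> 'v \<Rightarrow> 'h operator" where
  "P0 c R = (mat 1 - num c R 1) ** (mat 1 - num c R 2) ** (mat 1 - num c R 3) ** (mat 1 - num c R 4)"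

definition P4 :: "('v \<Rightarrow> nat \<Rightarrow> 'h::finite operator) \<Rightarrow> 'v \<Rightarrow> 'h operator" where
  "P4 c R = num c R 1 ** num c R 2 ** num c R 3 ** num c R 4"

definition P_op :: "('v \<Rightarrow> nat \<Rightarrow> 'h::finite operator) \<Rightarrow> 'v \<Rightarrow> 'h operator" where
  "P_op c R = P0 c R + P4 c R"

definition h_edge :: "('v \<Rightarrow> nat \<Rightarrow> 'h::finite operator) \<Rightarrow> 'v \<Rightarrow> 'v \<Rightarrow> 'h operator" where
  "h_edge c R R' = (1/2) *\<^sub>R (P4 c R ** P0 c R' + P0 c R ** P4 c R'
                              - q_dag c R ** q_op c R' - q_dag c R' ** q_op c R)"


subsection \<open>Graph\<close>

text \<open>
  A finite simple graph on the vertex type \<open>'v\<close> is given by its symmetric irreflexive adjacency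
  relation, so \<open>E\<close> contains every undirected edge in both orientations.
\<close>

definition connected_graph :: "('v::finite \<times> 'v) set \<Rightarrow> bool" where
  "connected_graph E \<longleftrightarrow> sym E \<and> irrefl E \<and> E\<^sup>* = UNIV"

definition adjacency :: "('v::finite \<times> 'v) set \<Rightarrow> complex^'v^'v" where
  "adjacency E = (\<chi> R R'. if (R, R') \<in> E then 1 else 0)"

definition degree_matrix :: "('v::finite \<times> 'v) set \<Rightarrow> complex^'v^'v" where
  "degree_matrix E = (\<chi> R R'. if R = R' then of_nat (card {R''. (R, R'') \<in> E}) else 0)"

definition laplacian :: "('v::finite \<times> 'v) set \<Rightarrow> complex^'v^'v" where
  "laplacian E = degree_matrix E - adjacency E"


subsection \<open>Hamiltonian and states\<close>

text \<open>
  The factor \<open>1/2\<close> makes the sum over \<open>E\<close> count every undirected edge once; \<open>h_edge_commute\<close>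
  shows that both orientations of an edge contribute the same term.
\<close>

definition H_exact ::
  "real \<Rightarrow> real \<Rightarrow> ('v::finite \<times> 'v) set \<Rightarrow> ('v \<Rightarrow> nat \<Rightarrow> 'h::finite operator) \<Rightarrow> 'h operator" where
  "H_exact U J E c = U *\<^sub>R (\<Sum>R\<in>UNIV. mat 1 - P_op c R)
                     + J *\<^sub>R ((1/2) *\<^sub>R (\<Sum>(R, R')\<in>E. h_edge c R R'))"

definition Q_dag :: "('v::finite \<Rightarrow> nat \<Rightarrow> 'h::finite operator) \<Rightarrow> complex^'v \<Rightarrow> 'h operator" where
  "Q_dag c \<phi> = (\<Sum>R\<in>UNIV. cscale (\<phi> $ R) (q_dag c R))"

definition S_plus :: "('v::finite \<Rightarrow> nat \<Rightarrow> 'h::finite operator) \<Rightarrow> 'h operator" where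
  "S_plus c = (\<Sum>R\<in>UNIV. q_dag c R)"

definition unnormalized_state ::
  "('v::finite \<Rightarrow> nat \<Rightarrow> 'h::finite operator) \<Rightarrow> complex^'h \<Rightarrow> complex^'v \<Rightarrow> nat \<Rightarrow> complex^'h" where
  "unnormalized_state c vac \<phi> M = ((\<lambda>\<psi>. S_plus c *v \<psi>) ^^ (M - 1)) (Q_dag c \<phi> *v vac)"

definition state ::
  "('v::finite \<Rightarrow> nat \<Rightarrow> 'h::finite operator) \<Rightarrow> complex^'h \<Rightarrow> complex^'v \<Rightarrow> nat \<Rightarrow> complex^'h" where
  "state c vac \<phi> M = (1 / norm (unnormalized_state c vac \<phi> M)) *\<^sub>R unnormalized_state c vac \<phi> M"


subsection \<open>Consistency of the conventions\<close>

lemma dagger_dagger [simp]: "dagger (dagger A) = A"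
  by (simp add: dagger_def vec_eq_iff)

lemma dagger_mult: "dagger (A ** B) = dagger B ** dagger A"
  by (simp add: dagger_def matrix_matrix_mult_def vec_eq_iff mult.commute)

lemma dagger_add: "dagger (A + B) = dagger A + dagger B"
  by (simp add: dagger_def vec_eq_iff)

lemma dagger_0 [simp]: "dagger 0 = 0"
  by (simp add: dagger_def vec_eq_iff)

lemma car_creation:
  assumes "car c" "m \<in> {1..4}" "m' \<in> {1..4}"
  shows "anticommutator (dagger (c R m)) (dagger (c R' m')) = 0"
proof -
  have "anticommutator (c R' m') (c R m) = 0"
    using assms unfolding car_def by blast
  then have "dagger (anticommutator (c R' m') (c R m)) = 0"
    by simp
  then show ?thesis
    by (simp add: anticommutator_def dagger_add dagger_mult)
qed

lemma commute_mult:
  fixes A B C :: "'h::finite operator"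
  assumes "A ** B = B ** A" "A ** C = C ** A"
  shows "A ** (B ** C) = (B ** C) ** A"
  by (metis assms matrix_mul_assoc)

lemma matrix_diff_ldistrib: "A ** (B - C) = A ** B - A ** (C :: 'h::finite operator)"
  by (simp add: matrix_matrix_mult_def vec_eq_iff sum_subtractf algebra_simps)

lemma matrix_diff_rdistrib: "(B - C) ** A = B ** A - C ** (A :: 'h::finite operator)"
  by (simp add: matrix_matrix_mult_def vec_eq_iff sum_subtractf algebra_simps)

lemma matrix_minus_left: "(- A) ** B = - (A ** (B :: 'h::finite operator))"
  by (simp add: matrix_matrix_mult_def vec_eq_iff sum_negf)

lemma matrix_minus_right: "A ** (- B) = - (A ** (B :: 'h::finite operator))"
  by (simp add: matrix_matrix_mult_def vec_eq_iff sum_negf)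

lemma commute_one_minus:
  fixes A B :: "'h::finite operator"
  assumes "A ** B = B ** A"
  shows "A ** (mat 1 - B) = (mat 1 - B) ** A"
  by (simp add: matrix_diff_ldistrib matrix_diff_rdistrib assms)

lemma anticommute_commute:
  fixes A B C :: "'h::finite operator"
  assumes "anticommutator A B = 0" "anticommutator A C = 0"
  shows "A ** (B ** C) = (B ** C) ** A"
proof -
  have 1: "A ** B = - (B ** A)" and 2: "A ** C = - (C ** A)"
    using assms by (simp_all add: anticommutator_def eq_neg_iff_add_eq_0)
  have "A ** (B ** C) = (A ** B) ** C"
    by (rule matrix_mul_assoc)
  also have "\<dots> = - (B ** (A ** C))"
    by (simp add: 1 matrix_minus_left matrix_mul_assoc)
  also have "\<dots> = (B ** C) ** A"
    by (simp add: 2 matrix_minus_right matrix_mul_assoc)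
  finally show ?thesis .
qed

lemma num_commute:
  assumes "car c" "R \<noteq> R'" "m \<in> {1..4}" "m' \<in> {1..4}"
  shows "num c R m ** num c R' m' = num c R' m' ** num c R m"
proof -
  have cc: "anticommutator (c R m) (c R' m') = 0"
    and cd: "anticommutator (c R m) (dagger (c R' m')) = 0"
    and dc': "anticommutator (c R' m') (dagger (c R m)) = 0"
    using assms unfolding car_def by (metis (no_types))+
  have dc: "anticommutator (dagger (c R m)) (c R' m') = 0"
    using dc' by (simp add: anticommutator_def add.commute)
  have dd: "anticommutator (dagger (c R m)) (dagger (c R' m')) = 0"
    by (rule car_creation[OF assms(1,3,4)])
  have "c R m ** num c R' m' = num c R' m' ** c R m"
    unfolding num_def by (rule anticommute_commute[OF cd cc])
  moreover have "dagger (c R m) ** num c R' m' = num c R' m' ** dagger (c R m)"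
    unfolding num_def by (rule anticommute_commute[OF dd dc])
  ultimately have "num c R' m' ** (dagger (c R m) ** c R m) = (dagger (c R m) ** c R m) ** num c R' m'"
    by (intro commute_mult) simp_all
  then show ?thesis
    by (simp add: num_def)
qed

lemma P4_P0_commute:
  assumes "car c" "R \<noteq> R'"
  shows "P4 c R ** P0 c R' = P0 c R' ** P4 c R"
proof -
  have 1: "num c R' m' ** num c R m = num c R m ** num c R' m'"
    if "m \<in> {1..4}" "m' \<in> {1..4}" for m m'
    using num_commute[OF assms that] by simp
  have 2: "num c R' m' ** P4 c R = P4 c R ** num c R' m'" if "m' \<in> {1..4}" for m'
    unfolding P4_def using that by (intro commute_mult 1) auto
  have 3: "P4 c R ** (mat 1 - num c R' m') = (mat 1 - num c R' m') ** P4 c R"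
    if "m' \<in> {1..4}" for m'
    using 2[OF that] by (intro commute_one_minus) simp
  show ?thesis
    unfolding P0_def by (intro commute_mult 3) auto
qed

lemma h_edge_commute:
  assumes "car c"
  shows "h_edge c R R' = h_edge c R' R"
proof (cases "R = R'")
  case False
  then show ?thesis
    using P4_P0_commute[OF assms, of R R'] P4_P0_commute[OF assms, of R' R]
    by (simp add: h_edge_def algebra_simps)
qed simp

text \<open>
  The hypotheses on the modes are satisfiable for every finite vertex type: the Jordan-Wigner
  representation on the Fock space spanned by the sets of occupied modes.
\<close>

definition jw_sign :: "('k \<Rightarrow> nat) \<Rightarrow> 'k \<Rightarrow> 'k set \<Rightarrow> complex" where
  "jw_sign f k S = (\<Prod>j\<in>S. if f j < f k then -1 else 1)"

definition jw :: "('k::finite \<Rightarrow> nat) \<Rightarrow> 'k \<Rightarrow> 'k set operator" where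
  "jw f k = (\<chi> S T. if k \<notin> S \<and> T = insert k S then jw_sign f k S else 0)"

lemma jw_sign_insert:
  "jw_sign f k (insert l S) =
    (if l \<in> S then jw_sign f k S else (if f l < f k then -1 else 1) * jw_sign f k S)"
  for S :: "'k::finite set"
  by (simp add: jw_sign_def insert_absorb)

lemma jw_sign_remove:
  "l \<in> S \<Longrightarrow> jw_sign f k (S - {l}) = (if f l < f k then -1 else 1) * jw_sign f k S"
  for S :: "'k::finite set"
  using jw_sign_insert[of f k l "S - {l}"] by (simp add: insert_absorb)

lemma jw_sign_square: "jw_sign f k S * jw_sign f k S = 1"
  unfolding jw_sign_def by (simp flip: prod.distrib) (intro prod.neutral ballI, simp)

lemma cnj_jw_sign: "cnj (jw_sign f k S) = jw_sign f k S"
  unfolding jw_sign_def cnj_prod by (intro prod.cong) auto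

lemma jw_apply:
  "(jw f k *v \<psi>) $ S = (if k \<in> S then 0 else jw_sign f k S * \<psi> $ insert k S)"
  by (simp add: matrix_vector_mult_def jw_def if_distrib[of "\<lambda>x. x * _"] cong: if_cong)

lemma dagger_jw_apply:
  "(dagger (jw f k) *v \<psi>) $ S = (if k \<in> S then jw_sign f k (S - {k}) * \<psi> $ (S - {k}) else 0)"
proof -
  have "k \<notin> T \<and> S = insert k T \<longleftrightarrow> k \<in> S \<and> T = S - {k}" for T
    by auto
  then show ?thesis
    by (simp add: matrix_vector_mult_def dagger_def jw_def cnj_jw_sign
        if_distrib[of "\<lambda>x. x * _"] if_distrib[of cnj] cong: if_cong)
qed

lemma jw_anticommutator:
  assumes "inj f"
  shows "anticommutator (jw f k) (jw f l) = 0"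
proof -
  have "f k < f l \<or> f l < f k" if "k \<noteq> l"
    using that assms by (metis injD linorder_neqE_nat)
  then have "(anticommutator (jw f k) (jw f l) *v \<psi>) $ S = 0" for \<psi> S
    by (auto simp: anticommutator_def matrix_vector_mult_add_rdistrib jw_apply jw_sign_insert
        insert_commute simp flip: matrix_vector_mul_assoc)
  then show ?thesis
    unfolding matrix_eq by (simp add: vec_eq_iff)
qed

lemma jw_dagger_anticommutator:
  assumes "inj f"
  shows "anticommutator (jw f k) (dagger (jw f l)) = (if k = l then mat 1 else 0)"
proof (cases "k = l")
  case True
  have "(anticommutator (jw f k) (dagger (jw f k)) *v \<psi>) $ S = \<psi> $ S" for \<psi> S
    using jw_sign_square[of f k S]
    by (auto simp: anticommutator_def matrix_vector_mult_add_rdistrib jw_apply dagger_jw_apply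
        jw_sign_insert jw_sign_remove jw_sign_square insert_absorb
        simp flip: matrix_vector_mul_assoc mult.assoc)
  then show ?thesis
    using True unfolding matrix_eq by (simp add: vec_eq_iff)
next
  case False
  then have "f k < f l \<or> f l < f k"
    using assms by (metis injD linorder_neqE_nat)
  then have "(anticommutator (jw f k) (dagger (jw f l)) *v \<psi>) $ S = 0" for \<psi> S
    using False
    by (auto simp: anticommutator_def matrix_vector_mult_add_rdistrib jw_apply dagger_jw_apply
        jw_sign_insert jw_sign_remove insert_Diff_if
        simp flip: matrix_vector_mul_assoc)
  then show ?thesis
    using False unfolding matrix_eq by (simp add: vec_eq_iff)
qed

lemma car_vacuum_exist:
  "\<exists>(c :: 'v::finite \<Rightarrow> nat \<Rightarrow> ('v \<times> 4) set operator) vac. car c \<and> vacuum c vac"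
proof -
  obtain f :: "'v \<times> 4 \<Rightarrow> nat" where f: "inj f"
    using finite_imp_inj_to_nat_seg[of "UNIV :: ('v \<times> 4) set"] by auto
  define c where "c = (\<lambda>(R::'v) m. jw f (R, of_nat m :: 4))"
  define vac :: "complex^(('v \<times> 4) set)" where "vac = axis {} 1"
  have inj4: "(of_nat m :: 4) = of_nat m' \<longleftrightarrow> m = m'" if "m \<in> {1..4}" "m' \<in> {1..4}" for m m'
  proof -
    have "{1..4::nat} = {1, 2, 3, 4}"
      by auto
    then show ?thesis
      using that by auto
  qed
  have "car c"
    unfolding car_def c_def using inj4
    by (simp add: jw_anticommutator[OF f] jw_dagger_anticommutator[OF f])
  moreover have "vacuum c vac"
  proof -
    have "norm vac = 1"
      unfolding vac_def by simp
    then show ?thesis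
      by (auto simp: vacuum_def c_def vac_def vec_eq_iff jw_apply axis_def)
  qed
  ultimately show ?thesis
    by blast
qed

end

theory Submission
  imports Defs "HOL-Combinatorics.Transposition"
begin

text \<open>
  Let \<open>|A\<rangle>\<close> be the state with all modes of the cells in \<open>A\<close> filled and all others empty. The penalty
  terms \<open>1 - P\<^sub>R\<close> vanish on these states, and the bond term acts as
  \<open>h\<^sub>R\<^sub>R\<^sub>' |A\<rangle> = (|A\<rangle> - |\<tau> A\<rangle>) / 2\<close> with \<open>\<tau>\<close> the transposition of \<open>R\<close> and \<open>R'\<close>. The unnormalized
  state is \<open>(M - 1)! \<Sum>\<^bsub>|A| = M\<^esub> f(A) |A\<rangle>\<close> with the additive function \<open>f(A) = \<Sum>\<^bsub>x \<in> A\<^esub> \<phi>(x)\<close>, and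
  moving \<open>\<tau>\<close> from \<open>|A\<rangle>\<close> to \<open>f\<close> turns the sum over bonds into the Laplacian acting on \<open>\<phi>\<close>. The state
  is nonzero because \<open>\<phi>\<close> takes two distinct values at some \<open>R\<close>, \<open>R'\<close>: for \<open>B\<close> of size \<open>M - 1\<close>
  avoiding both, \<open>f\<close> differs on \<open>B \<union> {R}\<close> and \<open>B \<union> {R'}\<close>.
\<close>

section \<open>Linearity of the matrix action on vectors\<close>

lemma sum_matrix_vector_mult:
  "(\<Sum>i\<in>I. A i) *v x = (\<Sum>i\<in>I. A i *v (x :: complex^'n))" for A :: "'i \<Rightarrow> complex^'n^'m"
  by (induction I rule: infinite_finite_induct) (simp_all add: matrix_vector_mult_add_rdistrib)

lemma matrix_vector_mult_sum:
  "A *v (\<Sum>i\<in>I. x i) = (\<Sum>i\<in>I. A *v x i)" for A :: "complex^'n^'m"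
  by (induction I rule: infinite_finite_induct) (simp_all add: matrix_vector_right_distrib)

lemma matrix_vector_mult_uminus: "A *v (- x) = - (A *v x)" for A :: "complex^'n^'m"
  by (metis matrix_vector_mult_diff_distrib matrix_vector_mult_0_right diff_0)

lemma cscale_vector_mult: "cscale a A *v x = a *s (A *v x)"
  by (simp add: cscale_def matrix_vector_mult_def vec_eq_iff sum_distrib_left mult.assoc)

lemma scaleR_complex_vec: "r *\<^sub>R x = complex_of_real r *s x" for x :: "complex^'n"
  unfolding vec_eq_iff vector_scaleR_component by (simp add: scaleR_conv_of_real[of r "_ :: complex"])

lemma scaleR_matrix_vector: "(r *\<^sub>R A) *v x = r *\<^sub>R (A *v x)" for A :: "complex^'n^'m"
  by (simp add: vec_eq_iff matrix_vector_mult_def scaleR_sum_right)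

lemma vec_scale_sum: "a *s (\<Sum>i\<in>I. x i) = (\<Sum>i\<in>I. a *s x i)" for x :: "'i \<Rightarrow> complex^'n"
  by (simp add: vec_eq_iff sum_distrib_left)

lemma sum_vec_scale: "(\<Sum>i\<in>I. a i) *s x = (\<Sum>i\<in>I. a i *s x)" for x :: "complex^'n"
  by (simp add: vec_eq_iff sum_distrib_right)


subsection \<open>Cells filled with quartets\<close>

locale fermionic_cells =
  fixes c :: "'v::finite \<Rightarrow> nat \<Rightarrow> 'h::finite operator" and vac :: "complex^'h"
  assumes car: "car c" and vacuum: "vacuum c vac"
begin

abbreviation "cd R m \<equiv> dagger (c R m)"

section \<open>Anticommutation relations, applied to vectors so that they rewrite nested
  products\<close>

lemma cd_cd:
  assumes "m \<in> {1..4}" "m' \<in> {1..4}"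
  shows "cd R m *v (cd R' m' *v x) = - (cd R' m' *v (cd R m *v x))"
proof -
  have "anticommutator (cd R m) (cd R' m') *v x = 0"
    by (simp add: car_creation[OF car assms])
  then show ?thesis
    by (simp add: anticommutator_def matrix_vector_mult_add_rdistrib matrix_vector_mul_assoc
        eq_neg_iff_add_eq_0)
qed

text \<open>Pauli principle: by \<open>cd_cd\<close> the vector equals its own negative.\<close>

lemma cd_cd_same:
  assumes "m \<in> {1..4}"
  shows "cd R m *v (cd R m *v x) = 0"
  using cd_cd[OF assms assms, of R R x] by (simp add: eq_neg_iff_add_eq_0 vec_eq_iff)

lemma c_cd_same:
  assumes "m \<in> {1..4}"
  shows "c R m *v (cd R m *v x) = x - cd R m *v (c R m *v x)"
proof -
  have "anticommutator (c R m) (cd R m) *v x = x"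
    using car assms by (simp add: car_def)
  then show ?thesis
    by (simp add: anticommutator_def matrix_vector_mult_add_rdistrib matrix_vector_mul_assoc
        eq_diff_eq)
qed

lemma c_cd:
  assumes "m \<in> {1..4}" "m' \<in> {1..4}" "R \<noteq> R' \<or> m \<noteq> m'"
  shows "c R m *v (cd R' m' *v x) = - (cd R' m' *v (c R m *v x))"
proof -
  have "anticommutator (c R m) (cd R' m') = 0"
    using car assms unfolding car_def by metis
  then have "anticommutator (c R m) (cd R' m') *v x = 0"
    by simp
  then show ?thesis
    by (simp add: anticommutator_def matrix_vector_mult_add_rdistrib matrix_vector_mul_assoc
        eq_neg_iff_add_eq_0)
qed

section \<open>Quartet operators\<close>

lemma q_dag_apply: "q_dag c R *v x = cd R 1 *v (cd R 2 *v (cd R 3 *v (cd R 4 *v x)))"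
  by (simp add: q_dag_def matrix_vector_mul_assoc matrix_mul_assoc)

lemma q_op_apply: "q_op c R *v x = c R 4 *v (c R 3 *v (c R 2 *v (c R 1 *v x)))"
  by (simp add: q_op_def q_dag_def dagger_mult matrix_vector_mul_assoc matrix_mul_assoc)

text \<open>A quartet is a product of four creation operators, so the signs picked up in passing it
  cancel, even for \<open>R = R'\<close>.\<close>

lemma cd_q_dag_commute:
  assumes "m \<in> {1..4}"
  shows "cd R m *v (q_dag c R' *v x) = q_dag c R' *v (cd R m *v x)"
  using assms by (simp add: q_dag_apply cd_cd[of m _ R R'] matrix_vector_mult_uminus)

lemma q_dag_commute: "q_dag c R *v (q_dag c R' *v x) = q_dag c R' *v (q_dag c R *v x)"
  \<comment> \<open>Only the two occurrences of one quartet are unfolded; its single modes then move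
    past the other, which stays intact.\<close>
  by (subst (1 4) q_dag_apply) (simp add: cd_q_dag_commute)

lemma cd_q_dag_same:
  assumes "m \<in> {1..4}"
  shows "cd R m *v (q_dag c R *v x) = 0"
proof -
  have "m = 1 \<or> m = 2 \<or> m = 3 \<or> m = 4"
    using assms by auto
  moreover have "q_dag c R *v (cd R 4 *v x) = 0"
    by (simp add: q_dag_apply cd_cd_same)
  moreover have "cd R 1 *v (q_dag c R *v x) = 0"
    by (simp add: q_dag_apply cd_cd_same)
  moreover have "cd R 2 *v (q_dag c R *v x) = 0"
    by (simp add: q_dag_apply cd_cd[of 2 1] cd_cd_same del: One_nat_def)
  moreover have "cd R 3 *v (q_dag c R *v x) = 0"
    by (simp add: q_dag_apply cd_cd[of 3 1] cd_cd[of 3 2] cd_cd_same del: One_nat_def)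
  ultimately show ?thesis
    by (auto simp: cd_q_dag_commute)
qed

lemma c_q_dag_commute:
  assumes "m \<in> {1..4}" "R \<noteq> R'"
  shows "c R m *v (q_dag c R' *v x) = q_dag c R' *v (c R m *v x)"
  using assms by (simp add: q_dag_apply c_cd[of m _ R R'] matrix_vector_mult_uminus)

lemma num_apply: "num c R m *v x = cd R m *v (c R m *v x)"
  by (simp add: num_def matrix_vector_mul_assoc)

text \<open>Filled cells get no predicate of their own: they appear as \<open>q_dag c R *v x\<close>
  with \<open>x\<close> empty in \<open>R\<close>.\<close>

definition empty_cell :: "'v \<Rightarrow> complex^'h \<Rightarrow> bool" where
  "empty_cell R x \<longleftrightarrow> (\<forall>m\<in>{1..4}. c R m *v x = 0)"

lemma empty_cell_ops:
  assumes "empty_cell R x"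
  shows "P0 c R *v x = x" "P4 c R *v x = 0" "q_op c R *v x = 0"
proof -
  have "c R m *v x = 0" if "m \<in> {1..4}" for m
    using assms that by (simp add: empty_cell_def)
  then show "P0 c R *v x = x" "P4 c R *v x = 0" "q_op c R *v x = 0"
    by (simp_all add: P0_def P4_def q_op_apply num_apply matrix_vector_mult_diff_rdistrib
        flip: matrix_vector_mul_assoc)
qed

text \<open>Every \<open>cd R m\<close> kills a vector with the quartet at \<open>R\<close> filled,
  so each \<open>num c R m\<close> acts on it as the identity. In \<open>q_op\<close> after
  \<open>q_dag\<close>, the modes cancel pairwise from the inside out because \<open>x\<close> is
  annihilated by each \<open>c R m\<close>.\<close>

lemma filled_cell_ops:
  assumes "empty_cell R x"
  shows "P0 c R *v (q_dag c R *v x) = 0"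
    and "P4 c R *v (q_dag c R *v x) = q_dag c R *v x"
    and "q_op c R *v (q_dag c R *v x) = x"
    and "q_dag c R *v (q_dag c R *v x) = 0"
proof -
  have n: "num c R m *v (q_dag c R *v x) = q_dag c R *v x" if "m \<in> {1..4}" for m
    using c_cd_same[OF that, of R "q_dag c R *v x"] cd_q_dag_same[OF that, of R x]
    by (simp add: num_apply)
  then show "P0 c R *v (q_dag c R *v x) = 0" "P4 c R *v (q_dag c R *v x) = q_dag c R *v x"
    by (simp_all add: P0_def P4_def matrix_vector_mult_diff_rdistrib flip: matrix_vector_mul_assoc)
  have "c R m *v x = 0" if "m \<in> {1..4}" for m
    using assms that by (simp add: empty_cell_def)
  then show "q_op c R *v (q_dag c R *v x) = x"
    by (simp add: q_op_apply q_dag_apply c_cd_same c_cd matrix_vector_mult_uminus)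
  show "q_dag c R *v (q_dag c R *v x) = 0"
    by (subst q_dag_apply) (simp add: cd_q_dag_same)
qed

text \<open>The fold is independent of the order of the cells because quartets commute
  (\<open>q_dag_commute\<close>); hence no ordering of the vertices and no signs enter.\<close>

definition ket :: "'v set \<Rightarrow> complex^'h" where
  "ket A = Finite_Set.fold (\<lambda>R x. q_dag c R *v x) vac A"

lemma ket_empty: "ket {} = vac"
  by (simp add: ket_def)

lemma ket_insert:
  assumes "R \<notin> A"
  shows "ket (insert R A) = q_dag c R *v ket A"
proof -
  interpret comp_fun_commute "\<lambda>R x. q_dag c R *v x"
    by unfold_locales (simp add: fun_eq_iff q_dag_commute)
  show ?thesis
    using assms by (simp add: ket_def)
qed

lemma empty_cell_ket:
  assumes "R \<notin> A"
  shows "empty_cell R (ket A)"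
  using finite[of A] assms
proof (induction A rule: finite_induct)
  case empty
  then show ?case
    using vacuum by (simp add: empty_cell_def ket_empty vacuum_def)
next
  case (insert R' A)
  then show ?case
    by (simp add: empty_cell_def ket_insert c_q_dag_commute)
qed

text \<open>For \<open>R \<in> A\<close> the quartet at \<open>R\<close> can be pulled to the front
  of \<open>ket A\<close>, leaving a vector empty in \<open>R\<close>, and
  \<open>filled_cell_ops\<close> applies.\<close>

lemma ops_ket:
  "P0 c R *v ket A = (if R \<in> A then 0 else ket A)"
  "P4 c R *v ket A = (if R \<in> A then ket A else 0)"
  "q_op c R *v ket A = (if R \<in> A then ket (A - {R}) else 0)"
  "q_dag c R *v ket A = (if R \<in> A then 0 else ket (insert R A))"
proof -
  have "ket A = q_dag c R *v ket (A - {R})" if "R \<in> A"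
    using that ket_insert[of R "A - {R}"] by (simp add: insert_absorb)
  moreover have "empty_cell R (ket (A - {R}))"
    by (simp add: empty_cell_ket)
  ultimately show
    "P0 c R *v ket A = (if R \<in> A then 0 else ket A)"
    "P4 c R *v ket A = (if R \<in> A then ket A else 0)"
    "q_op c R *v ket A = (if R \<in> A then ket (A - {R}) else 0)"
    "q_dag c R *v ket A = (if R \<in> A then 0 else ket (insert R A))"
    by (auto simp: filled_cell_ops empty_cell_ops empty_cell_ket ket_insert)
qed

lemma P_op_ket: "P_op c R *v ket A = ket A"
  by (simp add: P_op_def matrix_vector_mult_add_rdistrib ops_ket)

section \<open>Bond terms as transpositions of cells\<close>

abbreviation "swap_cells \<equiv> Transposition.transpose"

lemma transpose_image:
  "swap_cells R R' ` A =
    (if R \<in> A \<longleftrightarrow> R' \<in> A then A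
     else if R \<in> A then insert R' (A - {R}) else insert R (A - {R'}))"
  by (auto simp: Transposition.transpose_def image_def split: if_splits)

text \<open>If exactly one of the two cells is filled, one projector product gives
  \<open>ket A\<close> and one hopping term moves the quartet across. Otherwise all four terms
  vanish and the transposition fixes \<open>A\<close>.\<close>

lemma h_edge_ket:
  assumes "R \<noteq> R'"
  shows "h_edge c R R' *v ket A = (1/2) *s (ket A - ket (swap_cells R R' ` A))"
proof -
  have "h_edge c R R' *v ket A = (1/2) *s
      (P4 c R *v (P0 c R' *v ket A) + P0 c R *v (P4 c R' *v ket A)
       - q_dag c R *v (q_op c R' *v ket A) - q_dag c R' *v (q_op c R *v ket A))"
    by (simp add: h_edge_def matrix_vector_mult_add_rdistrib matrix_vector_mult_diff_rdistrib
        scaleR_complex_vec[of "1/2"] scaleR_matrix_vector flip: matrix_vector_mul_assoc)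
  also have "\<dots> = (1/2) *s (ket A - ket (swap_cells R R' ` A))"
    using assms by (auto simp: transpose_image ops_ket insert_absorb)
  finally show ?thesis .
qed


subsection \<open>Superpositions with additive coefficients\<close>

definition additive_state :: "complex^'v \<Rightarrow> nat \<Rightarrow> complex^'h" where
  "additive_state \<phi> M = (\<Sum>A | card A = M. (\<Sum>x\<in>A. \<phi> $ x) *s ket A)"

text \<open>A set \<open>B\<close> of size \<open>Suc M\<close> arises once from each
  \<open>R \<in> B\<close>, with coefficient f(B) - \<phi>(R). Summing over \<open>R\<close> gives
  (M + 1) f(B) - f(B) = M f(B).\<close>

lemma S_plus_additive_state:
  "S_plus c *v additive_state \<phi> M = of_nat M *s additive_state \<phi> (Suc M)"
proof -
  have "S_plus c *v additive_state \<phi> M =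
      (\<Sum>A | card A = M. \<Sum>R\<in>UNIV. (\<Sum>x\<in>A. \<phi> $ x) *s (q_dag c R *v ket A))"
    unfolding S_plus_def additive_state_def
    by (simp add: matrix_vector_mult_sum sum_matrix_vector_mult vector_scalar_commute vec_scale_sum)
  also have "\<dots> = (\<Sum>A | card A = M. \<Sum>R\<in>-A. (\<Sum>x\<in>A. \<phi> $ x) *s ket (insert R A))"
    by (intro sum.cong sum.mono_neutral_cong_right) (auto simp: ops_ket)
  also have "\<dots> = (\<Sum>(A, R)\<in>(SIGMA A:{A. card A = M}. - A). (\<Sum>x\<in>A. \<phi> $ x) *s ket (insert R A))"
    by (subst sum.Sigma) auto
  also have "\<dots> = (\<Sum>(B, R)\<in>(SIGMA B:{B. card B = Suc M}. B). (\<Sum>x\<in>B - {R}. \<phi> $ x) *s ket B)"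
    by (rule sum.reindex_bij_witness[where i = "\<lambda>(B, R). (B - {R}, R)"
          and j = "\<lambda>(A, R). (insert R A, R)"]) (auto simp: insert_absorb)
  also have "\<dots> = (\<Sum>B | card B = Suc M. \<Sum>R\<in>B. (\<Sum>x\<in>B - {R}. \<phi> $ x) *s ket B)"
    by (subst sum.Sigma) auto
  also have "\<dots> = (\<Sum>B | card B = Suc M. of_nat M *s ((\<Sum>x\<in>B. \<phi> $ x) *s ket B))"
  proof (rule sum.cong)
    fix B :: "'v set" assume "B \<in> {B. card B = Suc M}"
    then have "(\<Sum>R\<in>B. \<Sum>x\<in>B - {R}. \<phi> $ x) = of_nat M * (\<Sum>x\<in>B. \<phi> $ x)"
      by (simp add: sum_diff1 sum_subtractf algebra_simps)
    then show "(\<Sum>R\<in>B. (\<Sum>x\<in>B - {R}. \<phi> $ x) *s ket B) = of_nat M *s ((\<Sum>x\<in>B. \<phi> $ x) *s ket B)"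
      by (simp flip: sum_vec_scale)
  qed simp
  finally show ?thesis
    by (simp add: additive_state_def vec_scale_sum)
qed

lemma Q_dag_vac: "Q_dag c \<phi> *v vac = additive_state \<phi> 1"
proof -
  have "additive_state \<phi> 1 = (\<Sum>A\<in>(\<lambda>R. {R}) ` UNIV. (\<Sum>x\<in>A. \<phi> $ x) *s ket A)"
    unfolding additive_state_def by (intro sum.cong) (auto simp: card_1_singleton_iff)
  also have "\<dots> = (\<Sum>R\<in>UNIV. \<phi> $ R *s ket {R})"
    by (subst sum.reindex) auto
  finally show ?thesis
    by (simp add: Q_dag_def sum_matrix_vector_mult cscale_vector_mult ket_insert ket_empty)
qed

text \<open>The \<open>k\<close> applications of \<open>S_plus\<close> contribute the factors 1,
  ..., k.\<close>

lemma unnormalized_state_eq: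
  "unnormalized_state c vac \<phi> (Suc k) = of_nat (fact k) *s additive_state \<phi> (Suc k)"
proof (induction k)
  case 0
  then show ?case
    by (simp add: unnormalized_state_def Q_dag_vac)
next
  case (Suc k)
  have "unnormalized_state c vac \<phi> (Suc (Suc k)) = S_plus c *v unnormalized_state c vac \<phi> (Suc k)"
    by (simp add: unnormalized_state_def)
  then show ?case
    by (simp only: Suc vector_scalar_commute S_plus_additive_state)
      (simp add: vec_eq_iff algebra_simps)
qed

lemma sum_card_transpose:
  "(\<Sum>A | card A = M. g A *s ket (swap_cells R R' ` A)) =
   (\<Sum>A | card A = M. g (swap_cells R R' ` A) *s ket A)"
  by (rule sum.reindex_bij_witness[where i = "image (swap_cells R R')"
        and j = "image (swap_cells R R')"])
    (auto simp: image_image card_image)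

lemma laplacian_apply:
  "(laplacian E *v \<phi>) $ x = (\<Sum>y | (x, y) \<in> E. \<phi> $ x - \<phi> $ y)" for \<phi> :: "complex^'v"
proof -
  have "(laplacian E *v \<phi>) $ x =
      (\<Sum>y\<in>UNIV. (if x = y then of_nat (card {z. (x, z) \<in> E}) * \<phi> $ y else 0))
      - (\<Sum>y\<in>UNIV. (if (x, y) \<in> E then \<phi> $ y else 0))"
    unfolding laplacian_def degree_matrix_def adjacency_def matrix_vector_mult_def
    by (auto simp: left_diff_distrib sum_subtractf if_distrib[of "\<lambda>z. z * _"]
        cong: if_cong)
  also have "(\<Sum>y\<in>UNIV. (if (x, y) \<in> E then \<phi> $ y else 0)) = (\<Sum>y | (x, y) \<in> E. \<phi> $ y)"
    by (simp add: sum.If_cases)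
  finally show ?thesis
    by (simp add: sum_subtractf)
qed

text \<open>Only edges at \<open>x\<close> contribute, and each lies in \<open>E\<close> in both
  orientations, hence the factor 2. It cancels the 1/2 inside \<open>h_edge\<close>.\<close>

lemma sum_edges_transpose:
  fixes \<phi> :: "complex^'v"
  assumes "sym E" "irrefl E"
  shows "(\<Sum>(R, R')\<in>E. \<phi> $ x - \<phi> $ swap_cells R R' x) = 2 * (laplacian E *v \<phi>) $ x"
proof -
  have "(\<Sum>(R, R')\<in>E. \<phi> $ x - \<phi> $ swap_cells R R' x) =
     (\<Sum>(R, R')\<in>E. (if R = x then \<phi> $ x - \<phi> $ R' else 0) + (if R' = x then \<phi> $ x - \<phi> $ R else 0))"
    using assms(2) by (intro sum.cong) (auto simp: Transposition.transpose_def irrefl_def)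
  also have "\<dots> = (\<Sum>(R, R')\<in>E. (if R = x then \<phi> $ x - \<phi> $ R' else 0)) +
     (\<Sum>(R, R')\<in>E. (if R' = x then \<phi> $ x - \<phi> $ R else 0))"
    by (simp add: sum.distrib case_prod_unfold)
  also have "(\<Sum>(R, R')\<in>E. (if R' = x then \<phi> $ x - \<phi> $ R else 0)) =
     (\<Sum>(R, R')\<in>E. (if R = x then \<phi> $ x - \<phi> $ R' else 0))"
    by (rule sum.reindex_bij_witness[where i = prod.swap and j = prod.swap])
      (use assms(1) in \<open>auto dest: symD\<close>)
  also have "(\<Sum>(R, R')\<in>E. (if R = x then \<phi> $ x - \<phi> $ R' else 0)) =
     (\<Sum>(R, R')\<in>Pair x ` {y. (x, y) \<in> E}. \<phi> $ x - \<phi> $ R')"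
    by (intro sum.mono_neutral_cong_right) (auto split: if_splits)
  also have "\<dots> = (laplacian E *v \<phi>) $ x"
    by (subst sum.reindex) (auto simp: laplacian_apply inj_on_def)
  finally show ?thesis
    by simp
qed

text \<open>Additivity makes f(A) - f(\<tau> A) a sum over the single cells of \<open>A\<close>.
  After exchanging the sums over bonds and sets, the eigenvalue equation for \<phi> applies cell by
  cell.\<close>

lemma sum_h_edge_additive_state:
  assumes "sym E" "irrefl E" and eig: "laplacian E *v \<phi> = lam *s \<phi>"
  shows "(\<Sum>(R, R')\<in>E. h_edge c R R' *v additive_state \<phi> M) = lam *s additive_state \<phi> M"
proof -
  let ?f = "\<lambda>A. \<Sum>x\<in>A. \<phi> $ x"
  have bond: "h_edge c R R' *v additive_state \<phi> M =
      (\<Sum>A | card A = M. ((1/2) * (\<Sum>x\<in>A. \<phi> $ x - \<phi> $ swap_cells R R' x)) *s ket A)"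
    if "(R, R') \<in> E" for R R'
  proof -
    have "R \<noteq> R'"
      using that assms(2) by (auto simp: irrefl_def)
    then have "h_edge c R R' *v additive_state \<phi> M =
        (1/2) *s (additive_state \<phi> M - (\<Sum>A | card A = M. ?f A *s ket (swap_cells R R' ` A)))"
      unfolding additive_state_def matrix_vector_mult_sum vector_scalar_commute
      by (simp add: h_edge_ket vec_scale_sum sum_subtractf vec_eq_iff algebra_simps
          sum_distrib_left)
    also have "\<dots> = (1/2) *s (\<Sum>A | card A = M. (?f A - ?f (swap_cells R R' ` A)) *s ket A)"
      unfolding sum_card_transpose additive_state_def
      by (simp add: sum_subtractf vec_eq_iff left_diff_distrib)
    also have "\<dots> = (1/2) *s (\<Sum>A | card A = M. (\<Sum>x\<in>A. \<phi> $ x - \<phi> $ swap_cells R R' x) *s ket A)"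
      by (simp add: sum.reindex sum_subtractf)
    finally show ?thesis
      by (simp add: vec_scale_sum)
  qed
  have "(\<Sum>(R, R')\<in>E. h_edge c R R' *v additive_state \<phi> M) =
     (\<Sum>p\<in>E. \<Sum>A | card A = M.
        ((1/2) * (\<Sum>x\<in>A. \<phi> $ x - \<phi> $ swap_cells (fst p) (snd p) x)) *s ket A)"
    by (intro sum.cong) (auto simp: bond)
  also have "\<dots> = (\<Sum>A | card A = M. \<Sum>p\<in>E.
        ((1/2) * (\<Sum>x\<in>A. \<phi> $ x - \<phi> $ swap_cells (fst p) (snd p) x)) *s ket A)"
    by (rule sum.swap)
  also have "\<dots> = (\<Sum>A | card A = M. lam *s (?f A *s ket A))"
  proof (rule sum.cong)
    fix A :: "'v set"
    have "(\<Sum>p\<in>E. (1/2) * (\<Sum>x\<in>A. \<phi> $ x - \<phi> $ swap_cells (fst p) (snd p) x)) =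
        (1/2) * (\<Sum>x\<in>A. \<Sum>(R, R')\<in>E. \<phi> $ x - \<phi> $ swap_cells R R' x)"
      by (subst sum.swap) (simp add: sum_distrib_left case_prod_unfold)
    also have "\<dots> = lam * ?f A"
      unfolding sum_edges_transpose[OF assms(1,2)] eig by (simp add: sum_distrib_left)
    finally show "(\<Sum>p\<in>E. ((1/2) * (\<Sum>x\<in>A. \<phi> $ x - \<phi> $ swap_cells (fst p) (snd p) x)) *s ket A) =
        lam *s (?f A *s ket A)"
      by (simp flip: sum_vec_scale)
  qed simp
  finally show ?thesis
    by (simp add: additive_state_def vec_scale_sum)
qed

text \<open>The factor 1/2 in the eigenvalue is the one in \<open>H_exact\<close> that compensates
  for the two orientations of each edge.\<close>

lemma H_exact_additive_state:
  assumes "sym E" "irrefl E" "laplacian E *v \<phi> = lam *s \<phi>"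
  shows "H_exact U J E c *v additive_state \<phi> M =
    (complex_of_real (J / 2) * lam) *s additive_state \<phi> M"
proof -
  have "P_op c R *v additive_state \<phi> M = additive_state \<phi> M" for R
    by (simp add: additive_state_def matrix_vector_mult_sum vector_scalar_commute P_op_ket)
  then have "H_exact U J E c *v additive_state \<phi> M =
      J *\<^sub>R ((1/2) *\<^sub>R (\<Sum>(R, R')\<in>E. h_edge c R R' *v additive_state \<phi> M))"
    by (simp add: H_exact_def matrix_vector_mult_add_rdistrib matrix_vector_mult_diff_rdistrib
        sum_matrix_vector_mult case_prod_unfold scaleR_matrix_vector)
  then show ?thesis
    by (simp add: sum_h_edge_additive_state[OF assms] scaleR_complex_vec)
qed


subsection \<open>Nonvanishing\<close>

text \<open>Induction on \<open>A\<close>: \<open>q\<^sub>R\<close> with \<open>R \<in> A\<close> annihilates every basis state not containing \<open>R\<close>.\<close>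

lemma sum_ket_eq_0_imp:
  assumes "(\<Sum>A | card A = M. g A *s ket A) = 0" "card A = M"
  shows "g A = 0"
  using finite[of A] assms
proof (induction A arbitrary: M g rule: finite_induct)
  case empty
  then have "{A :: 'v set. card A = M} = {{}}"
    by auto
  moreover have "vac \<noteq> 0"
    using vacuum by (auto simp: vacuum_def)
  ultimately show ?case
    using empty by (simp add: ket_empty)
next
  case (insert R A)
  have M: "M = Suc (card A)"
    using insert by simp
  have "0 = q_op c R *v (\<Sum>B | card B = M. g B *s ket B)"
    by (simp add: insert)
  also have "\<dots> = (\<Sum>B | card B = M. g B *s (if R \<in> B then ket (B - {R}) else 0))"
    by (simp add: matrix_vector_mult_sum vector_scalar_commute ops_ket)
  also have "\<dots> = (\<Sum>B | card B = M \<and> R \<in> B. g B *s ket (B - {R}))"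
    by (intro sum.mono_neutral_cong_right) auto
  also have "\<dots> = (\<Sum>B | card B = card A \<and> R \<notin> B. g (insert R B) *s ket B)"
    by (rule sum.reindex_bij_witness[where i = "insert R" and j = "\<lambda>B. B - {R}"])
      (auto simp: insert_absorb M)
  \<comment> \<open>Zero coefficients on the sets containing \<open>R\<close> extend the sum to all
    sets of size \<open>card A\<close>, the form required by the induction hypothesis.\<close>
  also have "\<dots> = (\<Sum>B | card B = card A. (if R \<in> B then 0 else g (insert R B)) *s ket B)"
    by (intro sum.mono_neutral_cong_left) auto
  finally have "(if R \<in> A then 0 else g (insert R A)) = 0"
    by (intro insert.IH[of "\<lambda>B. if R \<in> B then 0 else g (insert R B)" "card A"]) auto
  then show ?case
    using insert by simp
qed

lemma additive_state_nonzero: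
  assumes "\<phi> \<noteq> 0" "(\<Sum>R\<in>UNIV. \<phi> $ R) = 0" "1 \<le> M" "M \<le> CARD('v) - 1"
  shows "additive_state \<phi> M \<noteq> 0"
proof
  assume zero: "additive_state \<phi> M = 0"
  have f: "(\<Sum>x\<in>A. \<phi> $ x) = 0" if "card A = M" for A
    using sum_ket_eq_0_imp[OF _ that] zero by (simp add: additive_state_def)
  have const: "\<phi> $ R = \<phi> $ R'" for R R'
  proof (cases "R = R'")
    case False
    \<comment> \<open>The upper bound on \<open>M\<close> leaves enough cells besides
      \<open>R\<close> and \<open>R'\<close>.\<close>
    have "M - 1 \<le> card (UNIV - {R, R'})"
      using False assms by (simp add: card_Diff_subset)
    then obtain B where B: "B \<subseteq> UNIV - {R, R'}" "card B = M - 1"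
      by (metis obtain_subset_with_card_n)
    then have "R \<notin> B" "R' \<notin> B"
      by auto
    then show ?thesis
      using f[of "insert R B"] f[of "insert R' B"] B assms by simp (metis add_right_imp_eq)
  qed simp
  obtain R where "\<phi> $ R \<noteq> 0"
    using assms(1) by (auto simp: vec_eq_iff)
  \<comment> \<open>A constant nonzero \<phi> cannot be orthogonal to the uniform vector.\<close>
  moreover have "(\<Sum>R'\<in>UNIV. \<phi> $ R') = of_nat CARD('v) * \<phi> $ R"
    by (subst sum.cong[OF refl const[of _ R]]) simp
  ultimately show False
    using assms(2) by simp
qed

end


theorem mainTheorem7:
  fixes E :: "('v::finite \<times> 'v) set"
    and c :: "'v \<Rightarrow> nat \<Rightarrow> complex^'h^'h"
    and vac :: "complex^'h"
    and U J :: real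
    and \<phi> :: "complex^'v"
    and lam :: complex
    and M :: nat
  assumes "connected_graph E"
    and "car c"
    and "vacuum c vac"
    and "U > 0" and "J > 0"
    and "\<phi> \<noteq> 0"
    and "laplacian E *v \<phi> = lam *s \<phi>"
    and "(\<Sum>R\<in>UNIV. \<phi> $ R) = 0"
    and "1 \<le> M" and "M \<le> CARD('v) - 1"
  shows "norm (state c vac \<phi> M) = 1 \<and>
    H_exact U J E c *v state c vac \<phi> M = (complex_of_real (J / 2) * lam) *s state c vac \<phi> M"
proof -
  interpret fermionic_cells c vac
    by unfold_locales fact+
  obtain k where k: "M = Suc k"
    using assms(9) by (cases M) auto
  have u: "unnormalized_state c vac \<phi> M = of_nat (fact k) *s additive_state \<phi> M"
    unfolding k by (rule unnormalized_state_eq)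
  have "unnormalized_state c vac \<phi> M \<noteq> 0"
    using additive_state_nonzero[OF assms(6,8,9,10)] unfolding u by (simp add: vector_mul_eq_0)
  then have "norm (state c vac \<phi> M) = 1"
    by (simp add: state_def)
  \<comment> \<open>Normalization and factorial are absorbed into one scalar, which commutes with
    the Hamiltonian.\<close>
  moreover obtain a where "state c vac \<phi> M = a *s additive_state \<phi> M"
    unfolding state_def u scaleR_complex_vec vector_smult_assoc by blast
  moreover have "sym E" "irrefl E"
    using assms(1) by (auto simp: connected_graph_def)
  ultimately show ?thesis
    by (simp add: vector_scalar_commute H_exact_additive_state[OF _ _ assms(7)] mult_ac)
qed

end
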